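(* For every election instance consisting of $k \ge 1$ offices with pairwise disjoint nonempty finite candidate sets $A_1,\dots,A_k$ and $n \ge 1$ voters with approval ballots $v_1,\dots,v_n \subseteq A = \bigcup_{j\in[k]} A_j$, there exists an office allocation $X$ satisfying Partial Justified Representation.
   Context: Setting. $[k]=\{1,\dots,k\}$. There are $k$ offices; office $j$ has a nonempty finite set $A_j$ of candidates, the sets $A_1,\dots,A_k$ are pairwise disjoint, and $A=\bigcup_{j\in[k]}A_j$. There are $n$ voters $V=\{v_1,\dots,v_n\}$; each voter $v$ is identified with her approval ballot $v\subseteq A$ (different voters may have identical ballots and are still counted separately, so $|V|=n$). An office allocation is a set $X=\{w_1,\dots,w_k\}$ with $w_j\in A_j$ for every $j\in[k]$. Definition (Partial Justified Representation). An office allocation $X$ satisfies Partial Justified Representation if for every nonempty group of voters $V'\subseteq V$ and every integer $k'$ with $1\le k'\le k$ the following holds: if there is a set $T\subseteq[k]$ with $|T|\ge k'$ such that $\left(\bigcap_{v\in V'}v\right)\cap A_j\neq\emptyset$ for all $j\in T$, and $\left\lfloor\frac{|V'|}{|V|}\,k'\right\rfloor>0$, then $\left(\bigcup_{v\in V'}v\right)\cap X\neq\emptyset$. *)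

theory Defs
  imports Complex_Main "HOL-Library.Disjoint_Sets"
begin

text \<open>
  Offices are the indices \<open>1..k\<close> with candidate sets \<open>A j\<close>. Voters are the indices \<open>1..n\<close>, and
  \<open>v i\<close> is the approval ballot of voter \<open>i\<close>; since voters are indices, voters with identical
  ballots are counted separately.
\<close>

definition election_instance ::
  "nat \<Rightarrow> nat \<Rightarrow> (nat \<Rightarrow> 'c set) \<Rightarrow> (nat \<Rightarrow> 'c set) \<Rightarrow> bool" where
  "election_instance k n A v \<longleftrightarrow>
     k \<ge> 1 \<and> n \<ge> 1 \<and>
     (\<forall>j\<in>{1..k}. finite (A j) \<and> A j \<noteq> {}) \<and>
     disjoint_family_on A {1..k} \<and>
     (\<forall>i\<in>{1..n}. v i \<subseteq> (\<Union>j\<in>{1..k}. A j))"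

definition office_allocation :: "nat \<Rightarrow> (nat \<Rightarrow> 'c set) \<Rightarrow> 'c set \<Rightarrow> bool" where
  "office_allocation k A X \<longleftrightarrow> (\<exists>w. (\<forall>j\<in>{1..k}. w j \<in> A j) \<and> X = w ` {1..k})"

definition partial_justified_representation ::
  "nat \<Rightarrow> nat \<Rightarrow> (nat \<Rightarrow> 'c set) \<Rightarrow> (nat \<Rightarrow> 'c set) \<Rightarrow> 'c set \<Rightarrow> bool" where
  "partial_justified_representation k n A v X \<longleftrightarrow>
     (\<forall>V' k'. V' \<subseteq> {1..n} \<longrightarrow> V' \<noteq> {} \<longrightarrow> 1 \<le> k' \<longrightarrow> k' \<le> k \<longrightarrow>
        (\<exists>T \<subseteq> {1..k}. card T \<ge> k' \<and> (\<forall>j\<in>T. (\<Inter>i\<in>V'. v i) \<inter> A j \<noteq> {})) \<longrightarrow>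
        \<lfloor>real (card V') / real n * real k'\<rfloor> > 0 \<longrightarrow>
        (\<Union>i\<in>V'. v i) \<inter> X \<noteq> {})"

end

theory Submission
  imports Defs
begin

text \<open>
  Fill the offices greedily, each time choosing, among all candidates for the open offices, one
  approved by the most voters that are still unrepresented. Let \<open>V'\<close> be a group that is never
  represented and whose members jointly approve a candidate for every office in \<open>T\<close>. As long as some
  office of \<open>T\<close> is open, one of these candidates is available, so the chosen one newly represents at
  least \<open>card V'\<close> voters. Hence at least \<open>card T * card V'\<close> voters outside \<open>V'\<close> are represented,
  which forces \<open>card T * card V' < n\<close>.
\<close>

text \<open>\<open>J\<close> stands for the open offices and \<open>U\<close> for the voters still
  unrepresented; both vary so that the induction can continue after each choice. The summand
  \<open>card V'\<close> counts the group itself, which is disjoint from the at least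
  \<open>card T * card V'\<close> voters of \<open>U\<close> represented by the selection.\<close>

lemma greedy_selection:
  fixes A :: "'o \<Rightarrow> 'c set" and v :: "'i \<Rightarrow> 'c set"
  assumes "finite J" and "finite U"
    and "\<And>j. j \<in> J \<Longrightarrow> finite (A j) \<and> A j \<noteq> {}"
  shows "\<exists>w. (\<forall>j\<in>J. w j \<in> A j) \<and>
    (\<forall>V' T. V' \<subseteq> U \<longrightarrow> T \<subseteq> J \<longrightarrow> (\<forall>i\<in>V'. v i \<inter> w ` J = {}) \<longrightarrow>
      (\<forall>j\<in>T. (\<Inter>i\<in>V'. v i) \<inter> A j \<noteq> {}) \<longrightarrow> card T * card V' + card V' \<le> card U)"
  using assms
proof (induction J arbitrary: U rule: finite_psubset_induct)
  case (psubset J)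
  show ?case
  proof (cases "J = {}")
    case True
    then show ?thesis using psubset.prems(1) by (auto intro: card_mono)
  next
    case False
    define P where "P = Sigma J A"
    define supp where "supp = (\<lambda>p::'o \<times> 'c. {i\<in>U. snd p \<in> v i})"
    have "finite P" "P \<noteq> {}"
      using False psubset.prems(2) psubset.hyps by (auto simp: P_def)
    then have "Max ((card \<circ> supp) ` P) \<in> (card \<circ> supp) ` P"
      by (intro Max_in) auto
    then obtain p where "p \<in> P" and p: "card (supp p) = Max ((card \<circ> supp) ` P)"
      by auto
    have max: "card (supp q) \<le> card (supp p)" if "q \<in> P" for q
      unfolding p using that \<open>finite P\<close> by (intro Max_ge) auto
    obtain j c where jc: "p = (j, c)" by fastforce
    have j: "j \<in> J" "c \<in> A j" using \<open>p \<in> P\<close> by (auto simp: P_def jc)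
    \<comment> \<open>The voters left unrepresented once \<open>c\<close> fills office
      \<open>j\<close>.\<close>
    define U' where "U' = U - supp p"
    have cardU: "card U = card U' + card (supp p)"
      using psubset.prems(1) card_Int_Diff[of U "supp p"]
      by (simp add: U'_def supp_def Int_def conj_commute)
    have "J - {j} \<subset> J" "finite U'" using j(1) psubset.prems(1) by (auto simp: U'_def)
    from psubset.IH[OF this] psubset.prems(2)
    obtain w where w: "\<forall>l\<in>J - {j}. w l \<in> A l"
      and w': "\<And>V' T. V' \<subseteq> U' \<Longrightarrow> T \<subseteq> J - {j} \<Longrightarrow> \<forall>i\<in>V'. v i \<inter> w ` (J - {j}) = {} \<Longrightarrow>
        \<forall>l\<in>T. (\<Inter>i\<in>V'. v i) \<inter> A l \<noteq> {} \<Longrightarrow> card T * card V' + card V' \<le> card U'"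
      by (smt (verit) DiffD1)
    define u where "u = w(j := c)"
    have uJ: "u ` J = insert c (w ` (J - {j}))"
      using j(1) by (auto simp: u_def)
    have "card T * card V' + card V' \<le> card U"
      if V: "V' \<subseteq> U" and T: "T \<subseteq> J" and un: "\<forall>i\<in>V'. v i \<inter> u ` J = {}"
        and com: "\<forall>l\<in>T. (\<Inter>i\<in>V'. v i) \<inter> A l \<noteq> {}" for V' T
    proof (cases "T = {}")
      case True
      then show ?thesis using V psubset.prems(1) by (auto intro: card_mono)
    next
      case False
      then obtain l d where "l \<in> T" and d: "d \<in> A l" "\<forall>i\<in>V'. d \<in> v i"
        using com by blast
      then have "(l, d) \<in> P" using T by (auto simp: P_def)
      \<comment> \<open>Office \<open>l\<close> is open and all of \<open>V'\<close> approve
        \<open>d\<close>, so \<open>(l, d)\<close> competed with \<open>p\<close> for the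
        maximum.\<close>
      have "card V' \<le> card (supp (l, d))"
        using V d psubset.prems(1) by (intro card_mono) (auto simp: supp_def)
      also have "\<dots> \<le> card (supp p)" by (rule max) fact
      finally have le: "card V' \<le> card (supp p)" .
      \<comment> \<open>No voter of \<open>V'\<close> approves \<open>c\<close>, so
        \<open>V'\<close> survives into \<open>U'\<close> and the induction hypothesis
        applies.\<close>
      have "card (T - {j}) * card V' + card V' \<le> card U'"
        using V T un com unfolding uJ
        by (intro w') (auto simp: U'_def supp_def jc)
      \<comment> \<open>Closing \<open>j\<close> costs \<open>T\<close> at most one office, hence
        one multiple of \<open>card V'\<close>; the voters in \<open>supp p\<close> pay for
        it.\<close>
      moreover have "card T \<le> Suc (card (T - {j}))"
        using card_Diff1_le[of T j] by (cases "finite T"; cases "j \<in> T") (auto simp: card_Suc_Diff1)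
      then have "card T * card V' \<le> card (T - {j}) * card V' + card V'"
        by (metis add.commute mult_Suc mult_le_mono1)
      ultimately show ?thesis using le cardU by linarith
    qed
    moreover have "\<forall>l\<in>J. u l \<in> A l" using w j by (auto simp: u_def)
    ultimately show ?thesis by blast
  qed
qed

theorem proposition4:
  fixes k n :: nat
    and A :: "nat \<Rightarrow> 'c set"
    and v :: "nat \<Rightarrow> 'c set"
  assumes "election_instance k n A v"
  shows "\<exists>X. office_allocation k A X \<and> partial_justified_representation k n A v X"
proof -
  have n: "n \<ge> 1" and A: "\<And>j. j \<in> {1..k} \<Longrightarrow> finite (A j) \<and> A j \<noteq> {}"
    using assms unfolding election_instance_def by blast+
  obtain w where w: "\<forall>j\<in>{1..k}. w j \<in> A j"
    and bound: "\<And>V' T. V' \<subseteq> {1..n} \<Longrightarrow> T \<subseteq> {1..k} \<Longrightarrow> \<forall>i\<in>V'. v i \<inter> w ` {1..k} = {} \<Longrightarrow>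
      \<forall>j\<in>T. (\<Inter>i\<in>V'. v i) \<inter> A j \<noteq> {} \<Longrightarrow> card T * card V' + card V' \<le> n"
    using greedy_selection[of "{1..k}" "{1..n}" A v] A by (auto simp del: atLeastAtMost_iff)
  have "partial_justified_representation k n A v (w ` {1..k})"
    unfolding partial_justified_representation_def
  proof (intro allI impI notI)
    fix V' k'
    assume V: "V' \<subseteq> {1..n}" "V' \<noteq> {}"
      and ex: "\<exists>T\<subseteq>{1..k}. k' \<le> card T \<and> (\<forall>j\<in>T. (\<Inter>i\<in>V'. v i) \<inter> A j \<noteq> {})"
      and fl: "0 < \<lfloor>real (card V') / real n * real k'\<rfloor>"
      and un: "(\<Union>i\<in>V'. v i) \<inter> w ` {1..k} = {}"
    obtain T where T: "T \<subseteq> {1..k}" "k' \<le> card T" "\<forall>j\<in>T. (\<Inter>i\<in>V'. v i) \<inter> A j \<noteq> {}"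
      using ex by blast
    have "1 \<le> real (card V') / real n * real k'"
      using fl by simp
    then have "real n \<le> real (card V' * k')"
      using n by (simp add: field_simps)
    then have "n \<le> k' * card V'"
      by (simp only: of_nat_le_iff mult.commute)
    also have "\<dots> \<le> card T * card V'"
      using T(2) by simp
    finally have "n \<le> card T * card V'" .
    moreover have "card T * card V' + card V' \<le> n"
      using V(1) T un by (intro bound) blast+
    \<comment> \<open>Nonemptiness makes the extra summand positive, so the two bounds on
      \<open>card T * card V'\<close> contradict each other.\<close>
    moreover have "card V' > 0"
      using V by (meson card_gt_0_iff finite_atLeastAtMost finite_subset)
    ultimately show False by linarith
  qed
  moreover have "office_allocation k A (w ` {1..k})"
    unfolding office_allocation_def using w by blast
  ultimately show ?thesis by blast
qed

end
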